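(* Let $X$ be a Gateaux smooth Banach space, let $\Omega\subsetneq X$ be a domain with quasihyperbolic metric $k$, and let $\gamma\colon[0,\ell]\to\Omega$ be a quasihyperbolic geodesic with unit quasihyperbolic speed between points $x_0,x\in\Omega$, of quasihyperbolic length $\ell$, with $\gamma(0)=x_0$ and $\gamma(\ell)=x$. Assume that $y=\gamma(t)$ for some $0<t<\ell$. Suppose that $k(x_0,\cdot)$ and $k(y,\cdot)$ are Gateaux differentiable at $x$ and that $\gamma$ has a left derivative at $\ell$. Then the Gateaux derivatives $k(x_0,\cdot)'(x)$ and $k(y,\cdot)'(x)$ coincide. In particular, the (unique) tangent spaces of the quasihyperbolic spheres $\mathbf{S}_k(x_0,\ell)$ and $\mathbf{S}_k(y,\ell-t)$ at $x$ coincide.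
   Context: $X$ is a real Banach space with $\dim X\ge2$; it is Gateaux smooth if its norm is Gateaux differentiable at every nonzero point. A domain is a nonempty open connected set. For a domain $\Omega\subsetneq X$ write $d(x)=\mathrm{dist}(x,\partial\Omega)$. The quasihyperbolic length of a rectifiable path $\gamma$ in $\Omega$ is $\ell_k(\gamma)=\int_\gamma \frac{\|d\gamma\|}{d(\gamma)}$ (integral with respect to norm arc length), and the quasihyperbolic metric is $k(x,y)=\inf_\gamma\ell_k(\gamma)$, the infimum being over all rectifiable paths $\gamma$ in $\Omega$ joining $x$ and $y$. A quasihyperbolic geodesic between $x_0$ and $x$ is a rectifiable path joining them whose quasihyperbolic length equals $k(x_0,x)$; it has unit quasihyperbolic speed if the quasihyperbolic length of its restriction to each $[s,t]\subset[0,\ell]$ is $t-s$. The Gateaux derivative of $f\colon\Omega\to\mathbb{R}$ at $x$ is a bounded linear functional $f'(x)\in X^*$ with $f'(x)[z]=\lim_{h\to0}\frac{f(x+hz)-f(x)}{h}$ for all $z\in X$. The left derivative of $\gamma$ at $\ell$ is the norm limit $\lim_{s\to\ell^-}\frac{\gamma(\ell)-\gamma(s)}{\ell-s}$. $\mathbf{S}_k(a,r)=\{u\in\Omega: k(a,u)=r\}$. The tangent space of $\mathbf{S}_k(a,r)$ at a point $u$ of it where $k(a,\cdot)$ is Gateaux differentiable is the affine subspace $u+\ker k(a,\cdot)'(u)$. *)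

theory Defs
  imports "HOL-Analysis.Analysis"
begin

definition polygon_lengths :: "(real \<Rightarrow> 'a::real_normed_vector) \<Rightarrow> real \<Rightarrow> real \<Rightarrow> real set" where
  "polygon_lengths \<gamma> a b =
    {\<Sum>i<n. norm (\<gamma> (p (Suc i)) - \<gamma> (p i)) | (n::nat) (p::nat \<Rightarrow> real).
      mono_on {..n} p \<and> p 0 = a \<and> p n = b}"

definition arc_length :: "(real \<Rightarrow> 'a::real_normed_vector) \<Rightarrow> real \<Rightarrow> real \<Rightarrow> real" where
  "arc_length \<gamma> a b = Sup (polygon_lengths \<gamma> a b)"

text \<open>Degenerate parameter intervals (\<open>a = b\<close>) are allowed.\<close>

definition rectifiable_path :: "(real \<Rightarrow> 'a::real_normed_vector) \<Rightarrow> real \<Rightarrow> real \<Rightarrow> bool" where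
  "rectifiable_path \<gamma> a b \<longleftrightarrow>
    a \<le> b \<and> continuous_on {a..b} \<gamma> \<and> bdd_above (polygon_lengths \<gamma> a b)"

text \<open>
  The arc-length parametrisation of \<open>\<gamma>\<close> on \<open>{a..b}\<close>, meant for
  \<open>0 \<le> s \<le> arc_length \<gamma> a b\<close>. For a rectifiable path the value does not depend on the chosen
  parameter \<open>t\<close>: two parameters with the same \<open>arc_length \<gamma> a t\<close> bound an interval on which
  \<open>\<gamma>\<close> is constant.
\<close>

definition arc_length_param :: "(real \<Rightarrow> 'a::real_normed_vector) \<Rightarrow> real \<Rightarrow> real \<Rightarrow> real \<Rightarrow> 'a" where
  "arc_length_param \<gamma> a b s = \<gamma> (SOME t. t \<in> {a..b} \<and> arc_length \<gamma> a t = s)"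

definition qh_length :: "'a::real_normed_vector set \<Rightarrow> (real \<Rightarrow> 'a) \<Rightarrow> real \<Rightarrow> real \<Rightarrow> real" where
  "qh_length \<Omega> \<gamma> a b =
    integral {0..arc_length \<gamma> a b}
      (\<lambda>s. 1 / infdist (arc_length_param \<gamma> a b s) (frontier \<Omega>))"

definition qh_dist :: "'a::real_normed_vector set \<Rightarrow> 'a \<Rightarrow> 'a \<Rightarrow> real" where
  "qh_dist \<Omega> x y =
    Inf {qh_length \<Omega> \<gamma> a b | \<gamma> a b.
      rectifiable_path \<gamma> a b \<and> \<gamma> ` {a..b} \<subseteq> \<Omega> \<and> \<gamma> a = x \<and> \<gamma> b = y}"

definition qh_geodesic ::
  "'a::real_normed_vector set \<Rightarrow> (real \<Rightarrow> 'a) \<Rightarrow> real \<Rightarrow> real \<Rightarrow> 'a \<Rightarrow> 'a \<Rightarrow> bool" where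
  "qh_geodesic \<Omega> \<gamma> a b x y \<longleftrightarrow>
    rectifiable_path \<gamma> a b \<and> \<gamma> ` {a..b} \<subseteq> \<Omega> \<and> \<gamma> a = x \<and> \<gamma> b = y \<and>
    qh_length \<Omega> \<gamma> a b = qh_dist \<Omega> x y"

definition unit_qh_speed ::
  "'a::real_normed_vector set \<Rightarrow> (real \<Rightarrow> 'a) \<Rightarrow> real \<Rightarrow> real \<Rightarrow> bool" where
  "unit_qh_speed \<Omega> \<gamma> a b \<longleftrightarrow>
    (\<forall>s t. a \<le> s \<and> s \<le> t \<and> t \<le> b \<longrightarrow> qh_length \<Omega> \<gamma> s t = t - s)"

definition qh_sphere :: "'a::real_normed_vector set \<Rightarrow> 'a \<Rightarrow> real \<Rightarrow> 'a set" where
  "qh_sphere \<Omega> a r = {u \<in> \<Omega>. qh_dist \<Omega> a u = r}"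

text \<open>
  Functions are total here; for a function of interest only on an open set \<open>\<Omega>\<close> and a point
  \<open>x \<in> \<Omega>\<close>, the limit depends only on values in \<open>\<Omega>\<close>, since \<open>x + h *\<^sub>R z \<in> \<Omega>\<close> for all
  sufficiently small \<open>h\<close>.
\<close>

definition has_gateaux_deriv ::
  "('a::real_normed_vector \<Rightarrow> real) \<Rightarrow> ('a \<Rightarrow>\<^sub>L real) \<Rightarrow> 'a \<Rightarrow> bool" where
  "has_gateaux_deriv f D x \<longleftrightarrow>
    (\<forall>z. ((\<lambda>h. (f (x + h *\<^sub>R z) - f x) / h) \<longlongrightarrow> blinfun_apply D z) (at 0))"

definition gateaux_differentiable :: "('a::real_normed_vector \<Rightarrow> real) \<Rightarrow> 'a \<Rightarrow> bool" where
  "gateaux_differentiable f x \<longleftrightarrow> (\<exists>D. has_gateaux_deriv f D x)"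

definition gateaux_deriv :: "('a::real_normed_vector \<Rightarrow> real) \<Rightarrow> 'a \<Rightarrow> 'a \<Rightarrow>\<^sub>L real" where
  "gateaux_deriv f x = (THE D. has_gateaux_deriv f D x)"

definition is_qh_tangent_space ::
  "'a::real_normed_vector set \<Rightarrow> 'a \<Rightarrow> real \<Rightarrow> 'a \<Rightarrow> 'a set \<Rightarrow> bool" where
  "is_qh_tangent_space \<Omega> a r u T \<longleftrightarrow>
    u \<in> qh_sphere \<Omega> a r \<and>
    (\<exists>D. has_gateaux_deriv (qh_dist \<Omega> a) D u \<and> T = {u + v | v. blinfun_apply D v = 0})"

end

theory Submission
  imports Defs
begin

text \<open>
  By the triangle inequality \<open>k(x\<^sub>0,u) - k(y,u) \<le> k(x\<^sub>0,y)\<close>, and since \<open>y\<close> lies on a geodesic from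
  \<open>x\<^sub>0\<close> to \<open>x\<close> there is equality at \<open>u = x\<close>. So the difference of the two distance functions has a
  local maximum at \<open>x\<close>, where its Gateaux derivative therefore vanishes.
\<close>

section \<open>Inscribed polygons: gluing and splitting at a parameter\<close>

lemma polygon_lengthsI:
  "mono_on {..n} p \<Longrightarrow> p 0 = a \<Longrightarrow> p n = b \<Longrightarrow>
    (\<Sum>i<n. norm (\<gamma> (p (Suc i)) - \<gamma> (p i))) \<in> polygon_lengths \<gamma> a b"
  unfolding polygon_lengths_def by blast

lemma polygon_lengthsE:
  assumes "S \<in> polygon_lengths \<gamma> a b"
  obtains n p where "mono_on {..n} p" "p 0 = a" "p n = b"
    "S = (\<Sum>i<n. norm (\<gamma> (p (Suc i)) - \<gamma> (p i)))" "\<forall>i\<le>n. a \<le> p i \<and> p i \<le> b"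
proof -
  obtain n p where p: "mono_on {..n} p" "p 0 = a" "p n = b"
      "S = (\<Sum>i<n. norm (\<gamma> (p (Suc i)) - \<gamma> (p i)))"
    using assms unfolding polygon_lengths_def by blast
  moreover have "a \<le> p i \<and> p i \<le> b" if "i \<le> n" for i
    using mono_onD[OF p(1), of 0 i] mono_onD[OF p(1), of i n] p(2,3) that by auto
  ultimately show thesis using that by blast
qed

lemma chord_in_polygon_lengths:
  assumes "a \<le> b"
  shows "norm (\<gamma> b - \<gamma> a) \<in> polygon_lengths \<gamma> a b"
proof -
  have "mono_on {..1} (\<lambda>i::nat. if i = 0 then a else b)"
    using assms by (auto simp: mono_on_def)
  from polygon_lengthsI[OF this, of a b \<gamma>] show ?thesis by simp
qed

text \<open>Two inscribed polygons that share the vertex at parameter \<open>b\<close> are joined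
  there into one.\<close>

lemma polygon_lengths_concat:
  assumes "S \<in> polygon_lengths \<gamma> a b" "T \<in> polygon_lengths \<gamma> b c"
  shows "S + T \<in> polygon_lengths \<gamma> a c"
proof -
  obtain n p where p: "mono_on {..n} p" "p 0 = a" "p n = b"
      "S = (\<Sum>i<n. norm (\<gamma> (p (Suc i)) - \<gamma> (p i)))" "\<forall>i\<le>n. a \<le> p i \<and> p i \<le> b"
    using polygon_lengthsE[OF assms(1)] .
  obtain m q where q: "mono_on {..m} q" "q 0 = b" "q m = c"
      "T = (\<Sum>i<m. norm (\<gamma> (q (Suc i)) - \<gamma> (q i)))" "\<forall>i\<le>m. b \<le> q i \<and> q i \<le> c"
    using polygon_lengthsE[OF assms(2)] .
  \<comment> \<open>The two sequences overlap at index \<open>n\<close>, where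
    \<open>p n = q 0 = b\<close>; hence \<open>r (n + i) = q i\<close> holds for
    \<open>i = 0\<close> too.\<close>
  define r where "r i = (if i \<le> n then p i else q (i - n))" for i
  have r_add: "r (n + i) = q i" for i
    using p(3) q(2) by (auto simp: r_def)
  have "mono_on {..n + m} r"
  proof (rule mono_onI)
    fix i j assume ij: "i \<in> {..n + m}" "j \<in> {..n + m}" "i \<le> j"
    consider "j \<le> n" | "i \<le> n" "n < j" | "n < i" by linarith
    then show "r i \<le> r j"
    proof cases
      case 1
      then show ?thesis using ij mono_onD[OF p(1), of i j] by (auto simp: r_def)
    next
      case 2
      then show ?thesis 
        using ij p(5)[rule_format, of i] q(5)[rule_format, of "j - n"] order_trans[of "p i" b "q (j - n)"]
        by (auto simp: r_def le_diff_conv add.commute)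
    next
      case 3
      then show ?thesis using ij mono_onD[OF q(1), of "i - n" "j - n"] by (auto simp: r_def)
    qed
  qed
  moreover have "r 0 = a" "r (n + m) = c"
    using p(2) q(3) r_add by (auto simp: r_def)
  ultimately have "(\<Sum>i<n + m. norm (\<gamma> (r (Suc i)) - \<gamma> (r i))) \<in> polygon_lengths \<gamma> a c"
    by (rule polygon_lengthsI)
  moreover have "(\<Sum>i<n + k. f i) = (\<Sum>i<n. f i) + (\<Sum>i<k. f (n + i))" for k and f :: "nat \<Rightarrow> real"
    by (induction k) auto
  moreover have "(\<Sum>i<n. norm (\<gamma> (r (Suc i)) - \<gamma> (r i))) = S"
    unfolding p(4) by (rule sum.cong) (auto simp: r_def)
  moreover have "(\<Sum>i<m. norm (\<gamma> (r (Suc (n + i))) - \<gamma> (r (n + i)))) = T"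
    unfolding q(4) using r_add by (metis add_Suc_right)
  ultimately show ?thesis by simp
qed

text \<open>Inserting the vertex at \<open>b\<close> cannot shorten a polygon. Truncating all
  parameters at \<open>b\<close> from above and from below keeps the number of edges; edges lying
  entirely on the wrong side collapse to length 0.\<close>

lemma polygon_lengths_split:
  assumes "S \<in> polygon_lengths \<gamma> a c" "a \<le> b" "b \<le> c"
  obtains T U where "T \<in> polygon_lengths \<gamma> a b" "U \<in> polygon_lengths \<gamma> b c" "S \<le> T + U"
proof -
  obtain n p where p: "mono_on {..n} p" "p 0 = a" "p n = c"
      "S = (\<Sum>i<n. norm (\<gamma> (p (Suc i)) - \<gamma> (p i)))" "\<forall>i\<le>n. a \<le> p i \<and> p i \<le> c"
    using polygon_lengthsE[OF assms(1)] .
  let ?lo = "\<lambda>i. min (p i) b" and ?hi = "\<lambda>i. max (p i) b"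
  let ?T = "\<Sum>i<n. norm (\<gamma> (?lo (Suc i)) - \<gamma> (?lo i))"
  let ?U = "\<Sum>i<n. norm (\<gamma> (?hi (Suc i)) - \<gamma> (?hi i))"
  have "mono_on {..n} ?lo" "mono_on {..n} ?hi"
    using p(1) by (auto intro!: mono_onI min.mono max.mono dest: mono_onD)
  then have "?T \<in> polygon_lengths \<gamma> a b" "?U \<in> polygon_lengths \<gamma> b c"
    using assms p by (auto intro!: polygon_lengthsI)
  moreover have "S \<le> ?T + ?U"
    unfolding p(4) sum.distrib[symmetric]
  proof (rule sum_mono)
    fix i assume "i \<in> {..<n}"
    then have le: "p i \<le> p (Suc i)" using mono_onD[OF p(1), of i "Suc i"] by auto
    consider "p (Suc i) \<le> b" | "b \<le> p i" | "p i \<le> b" "b \<le> p (Suc i)" by linarith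
    then show "norm (\<gamma> (p (Suc i)) - \<gamma> (p i))
        \<le> norm (\<gamma> (?lo (Suc i)) - \<gamma> (?lo i)) + norm (\<gamma> (?hi (Suc i)) - \<gamma> (?hi i))"
    proof cases
      \<comment> \<open>This edge straddles \<open>b\<close>: the truncated edges meet at
        \<open>\<gamma> b\<close>, and the triangle inequality applies.\<close>
      case 3
      then show ?thesis
        using norm_triangle_ineq[of "\<gamma> b - \<gamma> (p i)" "\<gamma> (p (Suc i)) - \<gamma> b"] by (simp add: min_def max_def)
    qed (use le in \<open>auto simp: min_absorb1 max_absorb1 min_absorb2 max_absorb2\<close>)
  qed
  ultimately show thesis using that by blast
qed

section \<open>Rectifiability and additivity of arc length\<close>

text \<open>A polygon over \<open>{s..t}\<close> becomes one over \<open>{a..b}\<close> by adding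
  the chords over \<open>{a..s}\<close> and \<open>{t..b}\<close>, so the bound for the whole path
  serves for the part.\<close>

lemma rectifiable_path_subinterval:
  assumes "rectifiable_path \<gamma> a b" "a \<le> s" "s \<le> t" "t \<le> b"
  shows "rectifiable_path \<gamma> s t"
proof -
  obtain M where M: "\<And>S. S \<in> polygon_lengths \<gamma> a b \<Longrightarrow> S \<le> M"
    using assms(1) unfolding rectifiable_path_def bdd_above_def by blast
  have "S \<le> M" if "S \<in> polygon_lengths \<gamma> s t" for S
  proof -
    have "norm (\<gamma> s - \<gamma> a) + S + norm (\<gamma> b - \<gamma> t) \<in> polygon_lengths \<gamma> a b"
      using that assms by (blast intro: polygon_lengths_concat chord_in_polygon_lengths)
    from M[OF this] show ?thesis
      using norm_ge_zero[of "\<gamma> s - \<gamma> a"] norm_ge_zero[of "\<gamma> b - \<gamma> t"] by linarith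
  qed
  then show ?thesis
    using assms continuous_on_subset[of "{a..b}" \<gamma> "{s..t}"]
    unfolding rectifiable_path_def bdd_above_def by auto
qed

lemma rectifiable_path_concat:
  assumes "rectifiable_path \<gamma> a b" "rectifiable_path \<gamma> b c"
  shows "rectifiable_path \<gamma> a c"
proof -
  obtain M N where M: "\<And>S. S \<in> polygon_lengths \<gamma> a b \<Longrightarrow> S \<le> M"
    and N: "\<And>S. S \<in> polygon_lengths \<gamma> b c \<Longrightarrow> S \<le> N"
    using assms unfolding rectifiable_path_def bdd_above_def by blast
  have ab: "a \<le> b" "b \<le> c" and "continuous_on ({a..b} \<union> {b..c}) \<gamma>"
    using assms unfolding rectifiable_path_def by (auto intro: continuous_on_closed_Un)
  then have "continuous_on {a..c} \<gamma>" by (simp add: ivl_disj_un_two_touch(4))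
  moreover have "S \<le> M + N" if "S \<in> polygon_lengths \<gamma> a c" for S
    using polygon_lengths_split[OF that ab] M N by (metis add_mono order_trans)
  ultimately show ?thesis
    using ab unfolding rectifiable_path_def bdd_above_def by force
qed

lemma polygon_le_arc_length:
  "rectifiable_path \<gamma> a b \<Longrightarrow> S \<in> polygon_lengths \<gamma> a b \<Longrightarrow> S \<le> arc_length \<gamma> a b"
  unfolding arc_length_def rectifiable_path_def by (simp add: cSup_upper)

lemma chord_le_arc_length:
  "rectifiable_path \<gamma> a b \<Longrightarrow> norm (\<gamma> b - \<gamma> a) \<le> arc_length \<gamma> a b"
  by (simp add: polygon_le_arc_length chord_in_polygon_lengths rectifiable_path_def)

lemma arc_length_nonneg: "rectifiable_path \<gamma> a b \<Longrightarrow> 0 \<le> arc_length \<gamma> a b"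
  using chord_le_arc_length norm_ge_zero order_trans by blast

lemma less_arc_lengthE:
  assumes "rectifiable_path \<gamma> a b" "l < arc_length \<gamma> a b"
  obtains S where "S \<in> polygon_lengths \<gamma> a b" "l < S"
proof -
  have "polygon_lengths \<gamma> a b \<noteq> {}"
    using assms(1) chord_in_polygon_lengths unfolding rectifiable_path_def by blast
  then show thesis
    using assms that less_cSup_iff unfolding rectifiable_path_def arc_length_def by metis
qed

text \<open>Splitting polygons at \<open>b\<close> gives one inequality between the suprema, gluing
  them at \<open>b\<close> gives the other.\<close>

lemma arc_length_add:
  assumes "rectifiable_path \<gamma> a b" "rectifiable_path \<gamma> b c"
  shows "arc_length \<gamma> a c = arc_length \<gamma> a b + arc_length \<gamma> b c"
proof (rule antisym)
  note ac = rectifiable_path_concat[OF assms]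
  have ab: "a \<le> b" "b \<le> c" using assms unfolding rectifiable_path_def by auto
  show "arc_length \<gamma> a c \<le> arc_length \<gamma> a b + arc_length \<gamma> b c"
  proof (rule ccontr)
    assume "\<not> ?thesis"
    then obtain S where "S \<in> polygon_lengths \<gamma> a c" "arc_length \<gamma> a b + arc_length \<gamma> b c < S"
      using less_arc_lengthE[OF ac] by (metis not_le)
    then show False
      using polygon_lengths_split[OF _ ab] polygon_le_arc_length[OF assms(1)]
        polygon_le_arc_length[OF assms(2)] by (smt (verit))
  qed
  show "arc_length \<gamma> a b + arc_length \<gamma> b c \<le> arc_length \<gamma> a c"
  proof (rule ccontr)
    assume "\<not> ?thesis"
    \<comment> \<open>The polygons are chosen one after the other: what \<open>S\<close> leaves over
      is the threshold that \<open>T\<close> has to exceed, so that \<open>S + T\<close> exceeds the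
      arc length over \<open>{a..c}\<close>.\<close>
    then have "arc_length \<gamma> a c - arc_length \<gamma> b c < arc_length \<gamma> a b" by linarith
    then obtain S where S: "S \<in> polygon_lengths \<gamma> a b" "arc_length \<gamma> a c - arc_length \<gamma> b c < S"
      using less_arc_lengthE[OF assms(1)] by metis
    then have "arc_length \<gamma> a c - S < arc_length \<gamma> b c" by linarith
    then obtain T where "T \<in> polygon_lengths \<gamma> b c" "arc_length \<gamma> a c - S < T"
      using less_arc_lengthE[OF assms(2)] by metis
    then show False
      using polygon_le_arc_length[OF ac polygon_lengths_concat[OF S(1)], of T] by linarith
  qed
qed

lemma arc_length_mono:
  assumes "rectifiable_path \<gamma> a b" "a \<le> s" "s \<le> t" "t \<le> b"
  shows "arc_length \<gamma> s t \<le> arc_length \<gamma> a b"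
proof -
  have "rectifiable_path \<gamma> a s" "rectifiable_path \<gamma> s t" "rectifiable_path \<gamma> t b" "rectifiable_path \<gamma> a t"
    using assms by (auto intro: rectifiable_path_subinterval)
  then show ?thesis
    using arc_length_add[of \<gamma> a s t] arc_length_add[of \<gamma> a t b] arc_length_nonneg by (smt (verit))
qed

section \<open>Continuity of arc length and the arc-length parametrisation\<close>

text \<open>One polygon longer than \<open>l\<close> is fixed and its vertices are moved into the
  varying interval. Its length varies continuously by continuity of \<open>\<gamma>\<close>, so it
  still exceeds \<open>l\<close> eventually. Letting both ends move covers a moving right end and a
  moving left end at once.\<close>

lemma arc_length_lower_semicontinuous:
  assumes rect: "rectifiable_path \<gamma> a b" and st: "a \<le> s" "s \<le> t" "t \<le> b"
    and lo: "(lo \<longlongrightarrow> s) F" and hi: "(hi \<longlongrightarrow> t) F"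
    and ev: "\<forall>\<^sub>F u in F. a \<le> lo u \<and> lo u \<le> hi u \<and> hi u \<le> b"
    and l: "l < arc_length \<gamma> s t"
  shows "\<forall>\<^sub>F u in F. l < arc_length \<gamma> (lo u) (hi u)"
proof -
  obtain S where S: "S \<in> polygon_lengths \<gamma> s t" "l < S"
    using less_arc_lengthE[OF rectifiable_path_subinterval[OF rect st] l] .
  obtain n p where p: "mono_on {..n} p" "p 0 = s" "p n = t"
      "S = (\<Sum>i<n. norm (\<gamma> (p (Suc i)) - \<gamma> (p i)))" "\<forall>i\<le>n. s \<le> p i \<and> p i \<le> t"
    using polygon_lengthsE[OF S(1)] .
  \<comment> \<open>Clamping to \<open>{lo u..hi u}\<close> preserves the order of the vertices, and
    the clamped vertices converge to \<open>p i\<close> because \<open>p i\<close> lies in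
    \<open>{s..t}\<close>.\<close>
  define q where "q u i = max (lo u) (min (hi u) (p i))" for u i
  have "((\<lambda>u. \<gamma> (q u i)) \<longlongrightarrow> \<gamma> (p i)) F" if "i \<le> n" for i
  proof (rule continuous_on_tendsto_compose[of "{a..b}"])
    show "continuous_on {a..b} \<gamma>" using rect unfolding rectifiable_path_def by simp
    have "((\<lambda>u. q u i) \<longlongrightarrow> max s (min t (p i))) F"
      unfolding q_def by (intro tendsto_intros lo hi)
    then show "((\<lambda>u. q u i) \<longlongrightarrow> p i) F" using p(5)[rule_format, OF that] by (simp add: max_absorb2 min_absorb2)
    show "p i \<in> {a..b}" using p(5)[rule_format, OF that] st by auto
    show "\<forall>\<^sub>F u in F. q u i \<in> {a..b}"
      using ev by eventually_elim (auto simp: q_def max_def min_def)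
  qed
  then have "((\<lambda>u. \<Sum>i<n. norm (\<gamma> (q u (Suc i)) - \<gamma> (q u i)))
      \<longlongrightarrow> (\<Sum>i<n. norm (\<gamma> (p (Suc i)) - \<gamma> (p i)))) F"
    by (intro tendsto_intros) auto
  from order_tendstoD(1)[OF this S(2)[unfolded p(4)]] ev show ?thesis
  proof eventually_elim
    case (elim u)
    have "mono_on {..n} (q u)"
      unfolding q_def
      by (intro mono_onI max.mono min.mono order_refl) (rule mono_onD[OF p(1)])
    then have "(\<Sum>i<n. norm (\<gamma> (q u (Suc i)) - \<gamma> (q u i))) \<in> polygon_lengths \<gamma> (q u 0) (q u n)"
      by (rule polygon_lengthsI) auto
    \<comment> \<open>The clamped end vertices may differ from \<open>lo u\<close> and
      \<open>hi u\<close>, so the polygon spans only a subinterval; monotonicity of arc length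
      closes the gap.\<close>
    moreover have le: "lo u \<le> q u 0" "q u 0 \<le> q u n" "q u n \<le> hi u"
      using elim \<open>mono_on {..n} (q u)\<close> by (auto simp: mono_on_def) (auto simp: q_def)
    moreover have rlh: "rectifiable_path \<gamma> (lo u) (hi u)"
      using rectifiable_path_subinterval[OF rect] elim by blast
    ultimately have "(\<Sum>i<n. norm (\<gamma> (q u (Suc i)) - \<gamma> (q u i))) \<le> arc_length \<gamma> (q u 0) (q u n)"
      using polygon_le_arc_length rectifiable_path_subinterval by blast
    also have "\<dots> \<le> arc_length \<gamma> (lo u) (hi u)" by (rule arc_length_mono[OF rlh le])
    finally show ?case using elim by linarith
  qed
qed

text \<open>The lengths over \<open>{a..u}\<close> and \<open>{u..b}\<close> have a constant sum and
  are both lower semicontinuous in \<open>u\<close>; for the second this means upper semicontinuity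
  of the first.\<close>

lemma continuous_on_arc_length:
  assumes rect: "rectifiable_path \<gamma> a b"
  shows "continuous_on {a..b} (arc_length \<gamma> a)"
  unfolding continuous_on
proof (intro ballI order_tendstoI)
  fix t assume t: "t \<in> {a..b}"
  let ?F = "at t within {a..b}"
  have in_ab: "\<forall>\<^sub>F u in ?F. u \<in> {a..b}" by (simp add: eventually_at_filter)
  have add: "arc_length \<gamma> a b = arc_length \<gamma> a u + arc_length \<gamma> u b" if "u \<in> {a..b}" for u
    using that rect by (intro arc_length_add) (auto intro: rectifiable_path_subinterval)
  show "\<forall>\<^sub>F u in ?F. l < arc_length \<gamma> a u" if "l < arc_length \<gamma> a t" for l
    using t in_ab that
    by (intro arc_length_lower_semicontinuous[OF rect, of a t])
      (auto elim!: eventually_mono intro: tendsto_ident_at)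
  fix r assume r: "arc_length \<gamma> a t < r"
  have "\<forall>\<^sub>F u in ?F. arc_length \<gamma> a b - r < arc_length \<gamma> u b"
    using t in_ab r add[OF t]
    by (intro arc_length_lower_semicontinuous[OF rect, of t b])
      (auto elim!: eventually_mono intro: tendsto_ident_at)
  with in_ab show "\<forall>\<^sub>F u in ?F. arc_length \<gamma> a u < r"
    by eventually_elim (use add in force)
qed

lemma arc_length_self:
  assumes "rectifiable_path \<gamma> a b"
  shows "arc_length \<gamma> a a = 0"
proof -
  have "rectifiable_path \<gamma> a a" using assms
    by (rule rectifiable_path_subinterval) (use assms in \<open>auto simp: rectifiable_path_def\<close>)
  \<comment> \<open>Additivity on the degenerate interval says that the length equals twice
    itself.\<close>
  from arc_length_add[OF this this] show ?thesis by simp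
qed

text \<open>By the intermediate value theorem, the choice in \<open>arc_length_param\<close> has a
  candidate at every point of the range of integration.\<close>

lemma arc_length_surj:
  assumes "rectifiable_path \<gamma> a b" "0 \<le> s" "s \<le> arc_length \<gamma> a b"
  obtains u where "u \<in> {a..b}" "arc_length \<gamma> a u = s"
  using IVT'[of "arc_length \<gamma> a" a s b] assms arc_length_self[OF assms(1)]
    continuous_on_arc_length[OF assms(1)]
  unfolding rectifiable_path_def by auto

text \<open>The choice in \<open>arc_length_param\<close> is harmless: parameters with equal arc
  length bound a piece of length 0, whose chord is then 0 as well.\<close>

lemma arc_length_param_eq:
  assumes rect: "rectifiable_path \<gamma> a b" and u: "u \<in> {a..b}"
  shows "arc_length_param \<gamma> a b (arc_length \<gamma> a u) = \<gamma> u"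
proof -
  have const: "\<gamma> v = \<gamma> w"
    if "v \<in> {a..b}" "w \<in> {a..b}" "v \<le> w" "arc_length \<gamma> a v = arc_length \<gamma> a w" for v w
  proof -
    have "rectifiable_path \<gamma> a v" "rectifiable_path \<gamma> v w"
      using that by (auto intro: rectifiable_path_subinterval[OF rect])
    then show ?thesis
      using arc_length_add[of \<gamma> a v w] chord_le_arc_length[of \<gamma> v w] that by simp
  qed
  define v where "v = (SOME v. v \<in> {a..b} \<and> arc_length \<gamma> a v = arc_length \<gamma> a u)"
  have "v \<in> {a..b} \<and> arc_length \<gamma> a v = arc_length \<gamma> a u"
    unfolding v_def by (rule someI[of _ u]) (use u in simp)
  then have "\<gamma> v = \<gamma> u" using const u by (metis linear)
  then show ?thesis unfolding arc_length_param_def v_def .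
qed

section \<open>Quasihyperbolic length under parameter shifts and concatenation\<close>

text \<open>The shift \<open>h\<close> lets a path be moved to start where another one ends;
  \<open>h = 0\<close> covers paths that agree merely on the interval.\<close>

lemma polygon_lengths_cong:
  assumes "\<And>s. s \<in> {a..b} \<Longrightarrow> \<gamma> s = \<sigma> (s + h)"
  shows "polygon_lengths \<gamma> a b = polygon_lengths \<sigma> (a + h) (b + h)"
proof (intro equalityI subsetI)
  fix S assume S: "S \<in> polygon_lengths \<gamma> a b"
  obtain n p where p: "mono_on {..n} p" "p 0 = a" "p n = b"
      "S = (\<Sum>i<n. norm (\<gamma> (p (Suc i)) - \<gamma> (p i)))" "\<forall>i\<le>n. a \<le> p i \<and> p i \<le> b"
    using polygon_lengthsE[OF S] .
  have "S = (\<Sum>i<n. norm (\<sigma> (p (Suc i) + h) - \<sigma> (p i + h)))"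
    unfolding p(4) by (rule sum.cong) (use p(5) assms in auto)
  also have "\<dots> \<in> polygon_lengths \<sigma> (a + h) (b + h)"
    by (rule polygon_lengthsI[of n "\<lambda>i. p i + h"]) (use p in \<open>auto simp: mono_on_def\<close>)
  finally show "S \<in> polygon_lengths \<sigma> (a + h) (b + h)" .
next
  fix S assume S: "S \<in> polygon_lengths \<sigma> (a + h) (b + h)"
  obtain n p where p: "mono_on {..n} p" "p 0 = a + h" "p n = b + h"
      "S = (\<Sum>i<n. norm (\<sigma> (p (Suc i)) - \<sigma> (p i)))" "\<forall>i\<le>n. a + h \<le> p i \<and> p i \<le> b + h"
    using polygon_lengthsE[OF S] .
  have eq: "\<sigma> (p i) = \<gamma> (p i - h)" if "i \<le> n" for i
    using assms[of "p i - h"] p(5)[rule_format, OF that] by auto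
  have "S = (\<Sum>i<n. norm (\<gamma> (p (Suc i) - h) - \<gamma> (p i - h)))"
    unfolding p(4) by (rule sum.cong) (use eq in auto)
  also have "\<dots> \<in> polygon_lengths \<gamma> a b"
    by (rule polygon_lengthsI[of n "\<lambda>i. p i - h"]) (use p in \<open>auto simp: mono_on_def\<close>)
  finally show "S \<in> polygon_lengths \<gamma> a b" .
qed

lemma arc_length_cong:
  assumes "\<And>s. s \<in> {a..b} \<Longrightarrow> \<gamma> s = \<sigma> (s + h)"
  shows "arc_length \<gamma> a b = arc_length \<sigma> (a + h) (b + h)"
  unfolding arc_length_def
  using polygon_lengths_cong[of a b \<gamma> \<sigma> h, OF assms] by simp

lemma rectifiable_path_cong:
  assumes "\<And>s. s \<in> {a..b} \<Longrightarrow> \<gamma> s = \<sigma> (s + h)" "rectifiable_path \<sigma> (a + h) (b + h)"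
  shows "rectifiable_path \<gamma> a b"
proof -
  have "continuous_on {a..b} (\<lambda>s. \<sigma> (s + h))"
    by (rule continuous_on_compose2[of "{a + h..b + h}" \<sigma>])
      (use assms(2) in \<open>auto simp: rectifiable_path_def intro!: continuous_intros\<close>)
  then have "continuous_on {a..b} \<gamma>" 
    by (rule continuous_on_eq) (simp add: assms(1))
  then show ?thesis
    using assms(2) polygon_lengths_cong[of a b \<gamma> \<sigma> h, OF assms(1)] unfolding rectifiable_path_def by auto
qed

text \<open>The parameters \<open>u\<close> and \<open>u + h\<close> have the same arc length from
  the start, so both paths have the same arc-length parametrisation and hence the same
  integrand.\<close>

lemma qh_length_cong:
  assumes eq: "\<And>s. s \<in> {a..b} \<Longrightarrow> \<gamma> s = \<sigma> (s + h)" and rect: "rectifiable_path \<sigma> (a + h) (b + h)"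
  shows "qh_length \<Omega> \<gamma> a b = qh_length \<Omega> \<sigma> (a + h) (b + h)"
proof -
  have rect': "rectifiable_path \<gamma> a b" by (rule rectifiable_path_cong[OF assms])
  have len: "arc_length \<gamma> a u = arc_length \<sigma> (a + h) (u + h)" if "u \<in> {a..b}" for u
    using that by (intro arc_length_cong eq) auto
  have "a \<le> b" using rect' unfolding rectifiable_path_def by simp
  have "arc_length_param \<gamma> a b s = arc_length_param \<sigma> (a + h) (b + h) s"
    if s: "s \<in> {0..arc_length \<gamma> a b}" for s
  proof -
    obtain u where u: "u \<in> {a..b}" "arc_length \<gamma> a u = s"
      using arc_length_surj[OF rect'] s by auto
    then show ?thesis
      using arc_length_param_eq[OF rect' u(1)] arc_length_param_eq[OF rect, of "u + h"] len[OF u(1)] eq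
      by auto
  qed
  then show ?thesis
    unfolding qh_length_def len[of b, symmetric, simplified, OF \<open>a \<le> b\<close>]
    by (intro integral_cong) simp
qed

text \<open>
  Equality holds as well, but only this inequality is independent of the integrability of \<open>1 / d\<close>
  along \<open>\<gamma>\<close>, since the integral of a non-integrable function is 0.
\<close>

lemma qh_length_concat_le:
  assumes "rectifiable_path \<gamma> a b" "rectifiable_path \<gamma> b c"
  shows "qh_length \<Omega> \<gamma> a c \<le> qh_length \<Omega> \<gamma> a b + qh_length \<Omega> \<gamma> b c"
proof -
  note ac = rectifiable_path_concat[OF assms]
  define A B where "A = arc_length \<gamma> a b" and "B = arc_length \<gamma> b c"
  define f where "f s = 1 / infdist (arc_length_param \<gamma> a c s) (frontier \<Omega>)" for s
  have AB: "0 \<le> A" "0 \<le> B" "arc_length \<gamma> a c = A + B" and abc: "a \<le> b" "b \<le> c"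
    using assms arc_length_nonneg[OF assms(1)] arc_length_nonneg[OF assms(2)] arc_length_add[OF assms]
    unfolding A_def B_def rectifiable_path_def by blast+
  have "arc_length_param \<gamma> a b s = arc_length_param \<gamma> a c s" if "s \<in> {0..A}" for s
  proof -
    obtain u where "u \<in> {a..b}" "arc_length \<gamma> a u = s"
      using arc_length_surj[OF assms(1)] \<open>s \<in> {0..A}\<close> unfolding A_def by auto
    then show ?thesis
      using arc_length_param_eq[OF assms(1)] arc_length_param_eq[OF ac] abc by force
  qed
  then have 1: "qh_length \<Omega> \<gamma> a b = integral {0..A} f"
    unfolding qh_length_def A_def[symmetric] f_def by (intro integral_cong) simp
  \<comment> \<open>Arc length on the second piece is counted from \<open>b\<close>, which lags by
    \<open>A\<close> behind counting from \<open>a\<close>; a translation of the integral absorbs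
    this.\<close>
  have "arc_length_param \<gamma> b c s = arc_length_param \<gamma> a c (s + A)" if "s \<in> {0..B}" for s
  proof -
    obtain u where u: "u \<in> {b..c}" "arc_length \<gamma> b u = s"
      using arc_length_surj[OF assms(2)] \<open>s \<in> {0..B}\<close> unfolding B_def by auto
    then have "arc_length \<gamma> a u = s + A"
      using arc_length_add[OF assms(1) rectifiable_path_subinterval[OF assms(2)], of u]
      by (simp add: A_def)
    then show ?thesis
      using u arc_length_param_eq[OF assms(2), of u] arc_length_param_eq[OF ac, of u] abc by auto
  qed
  then have "qh_length \<Omega> \<gamma> b c = integral {0..B} (\<lambda>s. f (s + A))"
    unfolding qh_length_def B_def[symmetric] f_def by (intro integral_cong) simp
  also have "\<dots> = integral {A..A + B} f"
    using integral_shift_real_ivl[of "A" "A" "A + B" f] by (simp add: add.commute)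
  finally have 2: "qh_length \<Omega> \<gamma> b c = integral {A..A + B} f" .
  have 3: "qh_length \<Omega> \<gamma> a c = integral {0..A + B} f"
    unfolding qh_length_def AB(3) f_def ..
  have f_nonneg: "0 \<le> f s" for s by (simp add: f_def infdist_nonneg)
  show ?thesis
  proof (cases "f integrable_on {0..A + B}")
    case True
    then show ?thesis
      unfolding 1 2 3 using Henstock_Kurzweil_Integration.integral_combine[of 0 A "A + B" f] AB by simp
  next
    case False
    have "0 \<le> integral S f" for S
      using f_nonneg integral_nonneg not_integrable_integral by (metis order_refl)
    then show ?thesis
      unfolding 1 2 3 not_integrable_integral[OF False] by simp
  qed
qed

text \<open>True without integrability, a non-integrable integrand having integral 0. It bounds
  below the set whose infimum is \<open>qh_dist\<close>.\<close>

lemma qh_length_nonneg: "0 \<le> qh_length \<Omega> \<gamma> a b"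
proof (cases "(\<lambda>s. 1 / infdist (arc_length_param \<gamma> a b s) (frontier \<Omega>)) integrable_on {0..arc_length \<gamma> a b}")
  case True
  then show ?thesis
    unfolding qh_length_def by (intro integral_nonneg) (auto simp: infdist_nonneg)
next
  case False
  then show ?thesis unfolding qh_length_def by (simp add: not_integrable_integral)
qed

section \<open>Quasihyperbolic distance and its triangle inequality\<close>

text \<open>These are the competitors in the infimum of \<open>qh_dist\<close>, which also ranges
  over the parameter interval.\<close>

definition joins :: "'a::real_normed_vector set \<Rightarrow> (real \<Rightarrow> 'a) \<Rightarrow> real \<Rightarrow> real \<Rightarrow> 'a \<Rightarrow> 'a \<Rightarrow> bool" where
  "joins \<Omega> \<gamma> a b x y \<longleftrightarrow>
    rectifiable_path \<gamma> a b \<and> \<gamma> ` {a..b} \<subseteq> \<Omega> \<and> \<gamma> a = x \<and> \<gamma> b = y"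

lemma joins_subinterval:
  "joins \<Omega> \<gamma> a b x y \<Longrightarrow> a \<le> s \<Longrightarrow> s \<le> t \<Longrightarrow> t \<le> b \<Longrightarrow> joins \<Omega> \<gamma> s t (\<gamma> s) (\<gamma> t)"
  using rectifiable_path_subinterval[of \<gamma> a b s t] unfolding joins_def by auto

lemma qh_dist_eq_Inf: "qh_dist \<Omega> x y = Inf {qh_length \<Omega> \<gamma> a b | \<gamma> a b. joins \<Omega> \<gamma> a b x y}"
  unfolding qh_dist_def joins_def ..

lemma qh_dist_le_length:
  assumes "joins \<Omega> \<gamma> a b x y"
  shows "qh_dist \<Omega> x y \<le> qh_length \<Omega> \<gamma> a b"
  unfolding qh_dist_eq_Inf
  by (rule cInf_lower) (use assms qh_length_nonneg in \<open>auto intro!: bdd_belowI[of _ 0]\<close>)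

text \<open>The given path serves to make the set of lengths nonempty, so that \<open>Inf\<close> is
  a genuine infimum.\<close>

lemma qh_dist_approx:
  assumes "joins \<Omega> \<gamma> a b x y" "0 < e"
  obtains \<sigma> c d where "joins \<Omega> \<sigma> c d x y" "qh_length \<Omega> \<sigma> c d < qh_dist \<Omega> x y + e"
proof -
  have "{qh_length \<Omega> \<gamma> a b | \<gamma> a b. joins \<Omega> \<gamma> a b x y} \<noteq> {}" using assms(1) by blast
  from cInf_lessD[OF this, of "qh_dist \<Omega> x y + e"] show thesis
    using assms(2) that unfolding qh_dist_eq_Inf by auto
qed

lemma joins_concat:
  assumes \<gamma>: "joins \<Omega> \<gamma> a b x y" and \<sigma>: "joins \<Omega> \<sigma> c d y z"
  obtains \<rho> e where "joins \<Omega> \<rho> a e x z"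
    "qh_length \<Omega> \<rho> a e \<le> qh_length \<Omega> \<gamma> a b + qh_length \<Omega> \<sigma> c d"
proof -
  \<comment> \<open>The shift \<open>c - b\<close> carries \<open>{b..?e}\<close> onto
    \<open>{c..d}\<close>. At \<open>s = b\<close> both branches give \<open>y\<close>, so
    \<open>\<rho>\<close> agrees with the shifted \<open>\<sigma>\<close> on the closed
    interval.\<close>
  define \<rho> where "\<rho> s = (if s \<le> b then \<gamma> s else \<sigma> (s + (c - b)))" for s
  let ?e = "b + (d - c)"
  have g: "rectifiable_path \<gamma> (a + 0) (b + 0)" "\<gamma> ` {a..b} \<subseteq> \<Omega>" "\<gamma> a = x" "\<gamma> b = y"
    using \<gamma> unfolding joins_def by auto
  have s: "rectifiable_path \<sigma> (b + (c - b)) (?e + (c - b))" "\<sigma> ` {c..d} \<subseteq> \<Omega>" "\<sigma> c = y" "\<sigma> d = z"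
    using \<sigma> unfolding joins_def by auto
  have le: "a \<le> b" "c \<le> d" using g s unfolding rectifiable_path_def by auto
  have 1: "\<rho> u = \<gamma> (u + 0)" if "u \<in> {a..b}" for u using that by (simp add: \<rho>_def)
  have 2: "\<rho> u = \<sigma> (u + (c - b))" if "u \<in> {b..?e}" for u
    using that g s by (auto simp: \<rho>_def)
  note r = rectifiable_path_cong[of a b \<rho> \<gamma> 0, OF 1 g(1)]
    rectifiable_path_cong[of b ?e \<rho> \<sigma> "c - b", OF 2 s(1)]
  have "\<rho> u \<in> \<Omega>" if "u \<in> {a..?e}" for u
  proof (cases "u \<le> b")
    case True
    then show ?thesis using that g(2) by (auto simp: \<rho>_def)
  next
    case False
    then have "u + (c - b) \<in> {c..d}" using that by auto
    then show ?thesis using False s(2) by (auto simp: \<rho>_def)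
  qed
  moreover have "\<rho> ?e = z" using 2[of ?e] le s by simp
  moreover have "\<rho> a = x" using 1[of a] le g by simp
  ultimately have "joins \<Omega> \<rho> a ?e x z"
    using rectifiable_path_concat[OF r] unfolding joins_def by blast
  moreover have "qh_length \<Omega> \<rho> a ?e \<le> qh_length \<Omega> \<gamma> a b + qh_length \<Omega> \<sigma> c d"
    using qh_length_concat_le[OF r, of \<Omega>] qh_length_cong[of a b \<rho> \<gamma> 0 \<Omega>, OF 1 g(1)]
      qh_length_cong[of b ?e \<rho> \<sigma> "c - b" \<Omega>, OF 2 s(1)] by simp
  ultimately show thesis using that by blast
qed

text \<open>Two paths that are minimal up to \<open>e / 2\<close> are concatenated. The assumed
  paths ensure that both infima on the right are over nonempty sets.\<close>

lemma qh_dist_triangle: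
  assumes "joins \<Omega> \<gamma> a b x y" "joins \<Omega> \<sigma> c d y z"
  shows "qh_dist \<Omega> x z \<le> qh_dist \<Omega> x y + qh_dist \<Omega> y z"
proof (rule field_le_epsilon)
  fix e :: real assume "0 < e"
  then have "0 < e / 2" by simp
  obtain \<gamma>' a' b' where g: "joins \<Omega> \<gamma>' a' b' x y" "qh_length \<Omega> \<gamma>' a' b' < qh_dist \<Omega> x y + e / 2"
    using qh_dist_approx[OF assms(1) \<open>0 < e / 2\<close>] .
  obtain \<sigma>' c' d' where s: "joins \<Omega> \<sigma>' c' d' y z" "qh_length \<Omega> \<sigma>' c' d' < qh_dist \<Omega> y z + e / 2"
    using qh_dist_approx[OF assms(2) \<open>0 < e / 2\<close>] .
  obtain \<rho> e' where "joins \<Omega> \<rho> a' e' x z"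
      "qh_length \<Omega> \<rho> a' e' \<le> qh_length \<Omega> \<gamma>' a' b' + qh_length \<Omega> \<sigma>' c' d'"
    using joins_concat[OF g(1) s(1)] .
  then show "qh_dist \<Omega> x z \<le> qh_dist \<Omega> x y + qh_dist \<Omega> y z + e"
    using qh_dist_le_length[of \<Omega> \<rho> a' e' x z] g(2) s(2) by linarith
qed

text \<open>Every inscribed polygon of a segment has length \<open>norm (u - x)\<close>, by
  telescoping. Segments are what connects \<open>x\<close> to the points of a small ball around
  it.\<close>

lemma joins_segment:
  assumes "closed_segment x u \<subseteq> \<Omega>"
  shows "joins \<Omega> (\<lambda>s. x + s *\<^sub>R (u - x)) 0 1 x u"
proof -
  have "S \<le> norm (u - x)" if S: "S \<in> polygon_lengths (\<lambda>s. x + s *\<^sub>R (u - x)) 0 1" for S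
  proof -
    obtain n p where p: "mono_on {..n} p" "p 0 = 0" "p n = 1"
      "S = (\<Sum>i<n. norm ((x + p (Suc i) *\<^sub>R (u - x)) - (x + p i *\<^sub>R (u - x))))"
      "\<forall>i\<le>n. 0 \<le> p i \<and> p i \<le> 1"
      using polygon_lengthsE[OF S] .
    have "norm ((x + p (Suc i) *\<^sub>R (u - x)) - (x + p i *\<^sub>R (u - x))) = (p (Suc i) - p i) * norm (u - x)"
      if "i < n" for i
    proof -
      have "(x + p (Suc i) *\<^sub>R (u - x)) - (x + p i *\<^sub>R (u - x)) = (p (Suc i) - p i) *\<^sub>R (u - x)"
        by (simp add: scaleR_left_diff_distrib)
      then show ?thesis using mono_onD[OF p(1), of i "Suc i"] that by simp
    qed
    then have "S = (\<Sum>i<n. p (Suc i) - p i) * norm (u - x)"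
      unfolding p(4) sum_distrib_right by (intro sum.cong) auto
    then show ?thesis using p(2,3) by (simp add: sum_lessThan_telescope)
  qed
  then have "bdd_above (polygon_lengths (\<lambda>s. x + s *\<^sub>R (u - x)) 0 1)"
    unfolding bdd_above_def by blast
  moreover have "(\<lambda>s. x + s *\<^sub>R (u - x)) ` {0..1} \<subseteq> \<Omega>"
    using assms by (force simp: closed_segment_def algebra_simps)
  ultimately show ?thesis
    unfolding joins_def rectifiable_path_def by (auto intro!: continuous_intros)
qed

section \<open>Gateaux derivatives at a local maximum of a difference\<close>

lemma gateaux_deriv_unique:
  assumes "has_gateaux_deriv f D x" "has_gateaux_deriv f E x"
  shows "D = E"
  using assms unfolding has_gateaux_deriv_def by (intro blinfun_eqI) (blast intro: LIM_unique)

lemma gateaux_deriv_eq: "has_gateaux_deriv f D x \<Longrightarrow> gateaux_deriv f x = D"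
  unfolding gateaux_deriv_def by (blast intro: gateaux_deriv_unique)

text \<open>Along each line through \<open>x\<close> the difference of \<open>f\<close> and
  \<open>g\<close> is a function of one real variable with a local maximum at 0. Its derivative
  there, \<open>D z - E z\<close> in direction \<open>z\<close>, therefore vanishes.\<close>

lemma has_gateaux_deriv_eq_at_local_max_of_diff:
  assumes D: "has_gateaux_deriv f D x" and E: "has_gateaux_deriv g E x"
    and "0 < e" and max: "\<And>u. u \<in> ball x e \<Longrightarrow> f u - g u \<le> f x - g x"
  shows "D = E"
proof (rule blinfun_eqI)
  fix z
  let ?\<phi> = "\<lambda>h. f (x + h *\<^sub>R z) - g (x + h *\<^sub>R z)"
  have "((\<lambda>h. f (x + h *\<^sub>R z)) has_field_derivative blinfun_apply D z) (at 0)"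
    "((\<lambda>h. g (x + h *\<^sub>R z)) has_field_derivative blinfun_apply E z) (at 0)"
    using D E unfolding has_gateaux_deriv_def DERIV_def by auto
  then have deriv: "(?\<phi> has_field_derivative blinfun_apply D z - blinfun_apply E z) (at 0)"
    by (rule DERIV_diff)
  \<comment> \<open>The radius makes \<open>\<bar>h\<bar> * norm z < e\<close>; the summand 1 keeps
    the denominator positive for \<open>z = 0\<close>.\<close>
  let ?d = "e / (norm z + 1)"
  have pos: "0 < norm z + 1" using norm_ge_zero[of z] by linarith
  have "?\<phi> h \<le> ?\<phi> 0" if "\<bar>0 - h\<bar> < ?d" for h
  proof -
    have "\<bar>h\<bar> * norm z \<le> \<bar>h\<bar> * (norm z + 1)" by (simp add: mult_left_mono)
    also have "\<dots> < e" using that pos by (simp add: pos_less_divide_eq)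
    finally have "x + h *\<^sub>R z \<in> ball x e" by (simp add: dist_norm)
    from max[OF this] show ?thesis by simp
  qed
  then show "blinfun_apply D z = blinfun_apply E z"
    using DERIV_local_max[OF deriv, of ?d] \<open>0 < e\<close> pos by simp
qed

section \<open>Coincidence of the derivatives and of the tangent spaces at the end of the
  geodesic\<close>

theorem corollary3p4:
  fixes \<Omega> :: "'a::banach set" and \<gamma> :: "real \<Rightarrow> 'a" and x\<^sub>0 x y :: 'a and L t :: real
  assumes dim_ge_2: "\<exists>u v :: 'a. u \<noteq> v \<and> independent {u, v}"
    and gateaux_smooth: "\<forall>u :: 'a. u \<noteq> 0 \<longrightarrow> gateaux_differentiable norm u"
    and domain: "open \<Omega>" "connected \<Omega>" "\<Omega> \<noteq> {}" "\<Omega> \<noteq> UNIV"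
    and geodesic: "qh_geodesic \<Omega> \<gamma> 0 L x\<^sub>0 x"
    and unit_speed: "unit_qh_speed \<Omega> \<gamma> 0 L"
    and length: "qh_length \<Omega> \<gamma> 0 L = L"
    and t: "0 < t" "t < L" and y: "y = \<gamma> t"
    and diff_x\<^sub>0: "gateaux_differentiable (qh_dist \<Omega> x\<^sub>0) x"
    and diff_y: "gateaux_differentiable (qh_dist \<Omega> y) x"
    and left_deriv: "\<exists>v. ((\<lambda>s. (\<gamma> L - \<gamma> s) /\<^sub>R (L - s)) \<longlongrightarrow> v) (at_left L)"
  shows "gateaux_deriv (qh_dist \<Omega> x\<^sub>0) x = gateaux_deriv (qh_dist \<Omega> y) x \<and>
    (\<exists>!T. is_qh_tangent_space \<Omega> x\<^sub>0 L x T) \<and>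
    (\<forall>T. is_qh_tangent_space \<Omega> x\<^sub>0 L x T \<longleftrightarrow> is_qh_tangent_space \<Omega> y (L - t) x T)"
proof -
  have \<gamma>: "joins \<Omega> \<gamma> 0 L x\<^sub>0 x" and dist_x\<^sub>0: "qh_dist \<Omega> x\<^sub>0 x = L"
    using geodesic length unfolding qh_geodesic_def joins_def by auto
  then have ends: "\<gamma> 0 = x\<^sub>0" "\<gamma> L = x" and "\<gamma> ` {0..L} \<subseteq> \<Omega>"
    unfolding joins_def by blast+
  moreover have "L \<in> {0..L}" using t by simp
  ultimately have "x \<in> \<Omega>" by blast
  have j1: "joins \<Omega> \<gamma> 0 t x\<^sub>0 y" and j2: "joins \<Omega> \<gamma> t L y x"
    using joins_subinterval[OF \<gamma>, of 0 t] joins_subinterval[OF \<gamma>, of t L] t y ends by auto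
  have "qh_length \<Omega> \<gamma> 0 t = t" "qh_length \<Omega> \<gamma> t L = L - t"
    using unit_speed t unfolding unit_qh_speed_def by force+
  then have le: "qh_dist \<Omega> x\<^sub>0 y \<le> t" "qh_dist \<Omega> y x \<le> L - t"
    using qh_dist_le_length[OF j1] qh_dist_le_length[OF j2] by auto
  \<comment> \<open>The triangle inequality gives
    \<open>L \<le> qh_dist \<Omega> x\<^sub>0 y + qh_dist \<Omega> y x\<close>, while the two
    summands are at most \<open>t\<close> and \<open>L - t\<close>; so both bounds are
    attained.\<close>
  then have dist_y: "qh_dist \<Omega> y x = L - t"
    using qh_dist_triangle[OF j1 j2] dist_x\<^sub>0 by linarith
  obtain e where e: "0 < e" "ball x e \<subseteq> \<Omega>"
    using \<open>x \<in> \<Omega>\<close> domain(1) open_contains_ball by blast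
  have max: "qh_dist \<Omega> x\<^sub>0 u - qh_dist \<Omega> y u \<le> qh_dist \<Omega> x\<^sub>0 x - qh_dist \<Omega> y x"
    if "u \<in> ball x e" for u
  proof -
    \<comment> \<open>The triangle inequality through \<open>y\<close> needs some path from
      \<open>y\<close> to \<open>u\<close>: it follows \<open>\<gamma>\<close> to \<open>x\<close>
      and then the segment to \<open>u\<close>, which stays in the ball and so in
      \<open>\<Omega>\<close>.\<close>
    have "closed_segment x u \<subseteq> ball x e"
      using that e(1) by (intro closed_segment_subset) auto
    then obtain \<rho> a b where "joins \<Omega> \<rho> a b y u"
      using joins_concat[OF j2 joins_segment] e(2) by (metis order_trans)
    from qh_dist_triangle[OF j1 this] show ?thesis
      using le(1) dist_x\<^sub>0 dist_y by linarith
  qed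
  obtain D E where D: "has_gateaux_deriv (qh_dist \<Omega> x\<^sub>0) D x" and E: "has_gateaux_deriv (qh_dist \<Omega> y) E x"
    using diff_x\<^sub>0 diff_y unfolding gateaux_differentiable_def by blast
  have "D = E" using has_gateaux_deriv_eq_at_local_max_of_diff[OF D E e(1) max] .
  \<comment> \<open>Since \<open>x\<close> lies on the sphere and the derivative is unique, the
    existential quantifier over derivatives leaves exactly one set \<open>T\<close>. Both spheres
    yield the same set, which gives uniqueness and coincidence together.\<close>
  have "is_qh_tangent_space \<Omega> x\<^sub>0 L x T \<longleftrightarrow> T = {x + v | v. blinfun_apply D v = 0}" for T
    using D gateaux_deriv_unique[OF D] \<open>x \<in> \<Omega>\<close> dist_x\<^sub>0
    unfolding is_qh_tangent_space_def qh_sphere_def by blast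
  moreover have "is_qh_tangent_space \<Omega> y (L - t) x T \<longleftrightarrow> T = {x + v | v. blinfun_apply D v = 0}" for T
    using E gateaux_deriv_unique[OF E] \<open>x \<in> \<Omega>\<close> dist_y \<open>D = E\<close>
    unfolding is_qh_tangent_space_def qh_sphere_def by blast
  ultimately show ?thesis
    using gateaux_deriv_eq[OF D] gateaux_deriv_eq[OF E] \<open>D = E\<close> by simp
qed

end
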